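(* Let $(G,\cdot)$ be a group and let $\psi:G\to G$ be an abelian map. Define $\phi:G\to G$ by $\phi(g)=g\psi(g^{-1})$ and $g\circ h=g\psi(g^{-1})h\psi(g)$ for $g,h\in G$, and let $\cdot'$ and $\circ'$ be the operations opposite to $\cdot$ and $\circ$. Let $H\le (G,\cdot)$ be a subgroup, let $G/H=\{xH:x\in G\}$, and consider the two conditions $$C_1:\ [G,\phi(H)]\le H;\qquad\qquad C_2:\ H\trianglelefteq (G,\cdot).$$ Then: 1. If $C_1$ holds, then $(G,\cdot,G/H,\circ,\odot)$ and $(G,\cdot,G/H,\circ',\odot)$ are bracoids, where $g\odot xH=gxH$. 2. If $C_2$ holds, then $(G,\circ,G/H,\cdot,\odot)$ and $(G,\circ,G/H,\cdot',\odot)$ are bracoids, where $g\odot xH=(g\circ x)H$. 3. If $C_1$ and $C_2$ both hold, then $(G/H,\cdot,\circ)$, $(G/H,\circ',\cdot)$ and $(G/H,\cdot',\circ)$ are braces. Here the operations on $G/H$ are those induced from the correspondingly denoted operations on $G$.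
   Context: A brace (skew left brace) is a triple $(B,\star,\bullet)$ where $(B,\star)$ (the additive group) and $(B,\bullet)$ (the multiplicative group) are groups, neither assumed abelian, with $a\bullet(b\star c)=(a\bullet b)\star a^{-1}\star(a\bullet c)$ for all $a,b,c\in B$, where $a^{-1}$ is the inverse in $(B,\star)$. A bracoid (skew bracoid) is a quintuple $(\Gamma,\bullet,N,\star,\odot)$ where $(\Gamma,\bullet)$ and $(N,\star)$ are groups and $\odot$ is a transitive action of $(\Gamma,\bullet)$ on the set $N$ such that $g\odot(\eta\star\mu)=(g\odot\eta)\star(g\odot e_N)^{-1}\star(g\odot\mu)$ for all $g\in\Gamma$, $\eta,\mu\in N$ (inverse in $(N,\star)$). An abelian map on a group $G$ is a group endomorphism $\psi:G\to G$ whose image $\psi(G)$ is abelian. It is known that for such $\psi$ the operation $g\circ h=g\psi(g^{-1})h\psi(g)$ makes $G$ a group and that $(G,\cdot,\circ)$ and $(G,\circ,\cdot)$ are both braces. The opposite operations are $g\cdot' h=h\cdot g$ and $g\circ' h=h\circ g$; then $(G,\cdot',\circ)$ and $(G,\circ',\cdot)$ are also braces. Juxtaposition and $g^{-1}$ refer to $(G,\cdot)$. Commutators are $[a,b]=aba^{-1}b^{-1}$ in $(G,\cdot)$, and $[G,\phi(H)]$ is the subgroup of $(G,\cdot)$ generated by all $[g,\phi(h)]$, $g\in G$, $h\in H$. When $C_1$ holds, $H$ is a normal subgroup of $(G,\circ)$ and the cosets $x\circ H$ and $xH$ coincide, so $G/H$ carries the quotient group operations $(xH)\circ(yH)=(x\circ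 y)H$ and $(xH)\circ'(yH)=(x\circ' y)H$. When $C_2$ holds, $G/H$ carries the usual quotient operations $(xH)\cdot(yH)=(xy)H$ and $(xH)\cdot'(yH)=(yx)H$. *)

theory Defs
  imports "HOL-Algebra.Group_Action" "HOL-Algebra.Left_Coset" "HOL-Algebra.Generated_Groups"
begin

text \<open>
  A quintuple or triple with several operations on one set is given by several group records:
  in a skew brace both records have the same carrier, the first one being the additive group.
\<close>

locale skew_brace = add: group A + mul: group M
  for A :: "('a, 'b) monoid_scheme" and M :: "('a, 'c) monoid_scheme" +
  assumes carrier_eq: "carrier M = carrier A"
    and brace_relation:
      "\<lbrakk>a \<in> carrier A; b \<in> carrier A; c \<in> carrier A\<rbrakk> \<Longrightarrow>
        a \<otimes>\<^bsub>M\<^esub> (b \<otimes>\<^bsub>A\<^esub> c) = ((a \<otimes>\<^bsub>M\<^esub> b) \<otimes>\<^bsub>A\<^esub> inv\<^bsub>A\<^esub> a) \<otimes>\<^bsub>A\<^esub> (a \<otimes>\<^bsub>M\<^esub> c)"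

text \<open>\<open>act g \<eta>\<close> plays the role of \<open>g \<odot> \<eta>\<close>; the set acted on is the carrier of \<open>N\<close>.\<close>

locale skew_bracoid = transitive_action \<Gamma> "carrier N" act + add: group N
  for \<Gamma> :: "('g, 'b) monoid_scheme" and N :: "('n, 'c) monoid_scheme"
    and act :: "'g \<Rightarrow> 'n \<Rightarrow> 'n" +
  assumes bracoid_relation:
      "\<lbrakk>g \<in> carrier \<Gamma>; \<eta> \<in> carrier N; \<mu> \<in> carrier N\<rbrakk> \<Longrightarrow>
        act g (\<eta> \<otimes>\<^bsub>N\<^esub> \<mu>) =
          (act g \<eta> \<otimes>\<^bsub>N\<^esub> inv\<^bsub>N\<^esub> (act g \<one>\<^bsub>N\<^esub>)) \<otimes>\<^bsub>N\<^esub> act g \<mu>"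

definition abelian_map :: "('a, 'b) monoid_scheme \<Rightarrow> ('a \<Rightarrow> 'a) \<Rightarrow> bool" where
  "abelian_map G \<psi> \<longleftrightarrow> \<psi> \<in> hom G G \<and>
    (\<forall>x \<in> \<psi> ` carrier G. \<forall>y \<in> \<psi> ` carrier G. x \<otimes>\<^bsub>G\<^esub> y = y \<otimes>\<^bsub>G\<^esub> x)"

definition phi_map :: "('a, 'b) monoid_scheme \<Rightarrow> ('a \<Rightarrow> 'a) \<Rightarrow> 'a \<Rightarrow> 'a" where
  "phi_map G \<psi> g = g \<otimes>\<^bsub>G\<^esub> \<psi> (inv\<^bsub>G\<^esub> g)"

definition circle_group :: "('a, 'b) monoid_scheme \<Rightarrow> ('a \<Rightarrow> 'a) \<Rightarrow> 'a monoid" where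
  "circle_group G \<psi> =
    \<lparr>carrier = carrier G,
     mult = (\<lambda>g h. g \<otimes>\<^bsub>G\<^esub> \<psi> (inv\<^bsub>G\<^esub> g) \<otimes>\<^bsub>G\<^esub> h \<otimes>\<^bsub>G\<^esub> \<psi> g),
     one = \<one>\<^bsub>G\<^esub>\<rparr>"

definition opposite_group :: "('a, 'b) monoid_scheme \<Rightarrow> 'a monoid" where
  "opposite_group G =
    \<lparr>carrier = carrier G, mult = (\<lambda>g h. h \<otimes>\<^bsub>G\<^esub> g), one = \<one>\<^bsub>G\<^esub>\<rparr>"

definition commutator_subgroup :: "('a, 'b) monoid_scheme \<Rightarrow> 'a set \<Rightarrow> 'a set \<Rightarrow> 'a set" where
  "commutator_subgroup G A B =
    generate G {a \<otimes>\<^bsub>G\<^esub> b \<otimes>\<^bsub>G\<^esub> inv\<^bsub>G\<^esub> a \<otimes>\<^bsub>G\<^esub> inv\<^bsub>G\<^esub> b | a b. a \<in> A \<and> b \<in> B}"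

text \<open>
  \<open>coset_quotient G H M\<close> is the set of left cosets \<open>x <#\<^bsub>G\<^esub> H\<close>, formed in \<open>G\<close>, with the
  operation induced from \<open>M\<close>, a second structure on \<open>carrier G\<close>. The product of two cosets is
  the union of the cosets of all products of representatives. It is a coset again only if that
  coset does not depend on the representatives, so closure under this operation already
  expresses that the induced operation is well-defined. Likewise for \<open>coset_action\<close>; there the
  restriction is needed because \<^const>\<open>BijGroup\<close> consists of extensional functions.
\<close>

definition coset_quotient ::
    "('a, 'b) monoid_scheme \<Rightarrow> 'a set \<Rightarrow> ('a, 'c) monoid_scheme \<Rightarrow> 'a set monoid" where
  "coset_quotient G H M =
    \<lparr>carrier = lcosets\<^bsub>G\<^esub> H,
     mult = (\<lambda>X Y. \<Union>x\<in>X. \<Union>y\<in>Y. (x \<otimes>\<^bsub>M\<^esub> y) <#\<^bsub>G\<^esub> H),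
     one = \<one>\<^bsub>M\<^esub> <#\<^bsub>G\<^esub> H\<rparr>"

definition coset_action ::
    "('a, 'b) monoid_scheme \<Rightarrow> 'a set \<Rightarrow> ('a, 'c) monoid_scheme \<Rightarrow> 'a \<Rightarrow> 'a set \<Rightarrow> 'a set" where
  "coset_action G H M g = (\<lambda>X \<in> lcosets\<^bsub>G\<^esub> H. \<Union>x\<in>X. (g \<otimes>\<^bsub>M\<^esub> x) <#\<^bsub>G\<^esub> H)"


text \<open>
  The remaining lemmas confirm that the induced operations and actions satisfy the equations
  by which they are usually introduced.
\<close>

context group
begin

lemma l_coset_absorb:
  assumes "subgroup H G" "x \<in> carrier G" "h \<in> H"
  shows "(x \<otimes> h) <# H = x <# H"
  using assms by (metis l_repr_independence l_coset_def UN_iff singletonI)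

lemma coset_quotient_mult:
  assumes "subgroup H G" "x \<in> carrier G" "y \<in> carrier G"
    and "\<And>h k. \<lbrakk>h \<in> H; k \<in> H\<rbrakk> \<Longrightarrow>
      ((x \<otimes> h) \<otimes>\<^bsub>M\<^esub> (y \<otimes> k)) <# H = (x \<otimes>\<^bsub>M\<^esub> y) <# H"
  shows "(x <# H) \<otimes>\<^bsub>coset_quotient G H M\<^esub> (y <# H) = (x \<otimes>\<^bsub>M\<^esub> y) <# H"
proof -
  have "H \<noteq> {}" using assms(1) subgroup.one_closed by blast
  moreover have "(x <# H) \<otimes>\<^bsub>coset_quotient G H M\<^esub> (y <# H) =
      (\<Union>h\<in>H. \<Union>k\<in>H. ((x \<otimes> h) \<otimes>\<^bsub>M\<^esub> (y \<otimes> k)) <# H)"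
    by (simp add: coset_quotient_def l_coset_def[of G x] l_coset_def[of G y])
  ultimately show ?thesis using assms(4) by simp
qed

lemma coset_action_apply:
  assumes "subgroup H G" "x \<in> carrier G"
    and "\<And>h. h \<in> H \<Longrightarrow> (g \<otimes>\<^bsub>M\<^esub> (x \<otimes> h)) <# H = (g \<otimes>\<^bsub>M\<^esub> x) <# H"
  shows "coset_action G H M g (x <# H) = (g \<otimes>\<^bsub>M\<^esub> x) <# H"
proof -
  have "H \<noteq> {}" using assms(1) subgroup.one_closed by blast
  moreover have "coset_action G H M g (x <# H) = (\<Union>h\<in>H. (g \<otimes>\<^bsub>M\<^esub> (x \<otimes> h)) <# H)"
  proof -
    have "x <# H \<in> lcosets H" using assms(2) by (auto simp: LCOSETS_def)
    then show ?thesis by (simp add: coset_action_def l_coset_def[of G x])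
  qed
  ultimately show ?thesis using assms(3) by simp
qed

lemma coset_action_self:
  assumes H: "subgroup H G" and "g \<in> carrier G" "x \<in> carrier G"
  shows "coset_action G H G g (x <# H) = (g \<otimes> x) <# H"
proof (rule coset_action_apply[OF H \<open>x \<in> carrier G\<close>])
  fix h assume "h \<in> H"
  then show "(g \<otimes> (x \<otimes> h)) <# H = (g \<otimes> x) <# H"
    using assms l_coset_absorb[OF H, of "g \<otimes> x" h] subgroup.mem_carrier[OF H]
    by (simp add: m_assoc)
qed

lemma abelian_mapD:
  assumes "abelian_map G \<psi>"
  shows "x \<in> carrier G \<Longrightarrow> \<psi> x \<in> carrier G"
    and "\<lbrakk>x \<in> carrier G; y \<in> carrier G\<rbrakk> \<Longrightarrow> \<psi> (x \<otimes> y) = \<psi> x \<otimes> \<psi> y"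
    and "x \<in> carrier G \<Longrightarrow> \<psi> (inv x) = inv (\<psi> x)"
    and "\<lbrakk>x \<in> carrier G; y \<in> carrier G\<rbrakk> \<Longrightarrow> \<psi> x \<otimes> \<psi> y = \<psi> y \<otimes> \<psi> x"
proof -
  have hom: "\<psi> \<in> hom G G" using assms by (simp add: abelian_map_def)
  then interpret group_hom G G \<psi> by unfold_locales
  show "x \<in> carrier G \<Longrightarrow> \<psi> x \<in> carrier G" by simp
  show "\<lbrakk>x \<in> carrier G; y \<in> carrier G\<rbrakk> \<Longrightarrow> \<psi> (x \<otimes> y) = \<psi> x \<otimes> \<psi> y" by simp
  show "x \<in> carrier G \<Longrightarrow> \<psi> (inv x) = inv (\<psi> x)" by simp
  show "\<lbrakk>x \<in> carrier G; y \<in> carrier G\<rbrakk> \<Longrightarrow> \<psi> x \<otimes> \<psi> y = \<psi> y \<otimes> \<psi> x"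
    using assms by (simp add: abelian_map_def)
qed

lemma inv_mult_cancel:
  "\<lbrakk>a \<in> carrier G; b \<in> carrier G\<rbrakk> \<Longrightarrow> inv a \<otimes> (a \<otimes> b) = b"
  "\<lbrakk>a \<in> carrier G; b \<in> carrier G\<rbrakk> \<Longrightarrow> a \<otimes> (inv a \<otimes> b) = b"
  by (simp_all add: m_assoc[symmetric])

lemma circle_closed:
  assumes "abelian_map G \<psi>" "x \<in> carrier G" "y \<in> carrier G"
  shows "x \<otimes>\<^bsub>circle_group G \<psi>\<^esub> y \<in> carrier G"
  using assms by (simp add: circle_group_def abelian_mapD)

lemma circle_mult_normal:
  assumes \<psi>: "abelian_map G \<psi>" and N: "H \<lhd> G" and x: "x \<in> carrier G" and y: "y \<in> carrier G"
    and h: "h \<in> H"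
  shows "(x \<otimes>\<^bsub>circle_group G \<psi>\<^esub> (y \<otimes> h)) <# H = (x \<otimes>\<^bsub>circle_group G \<psi>\<^esub> y) <# H"
proof -
  interpret normal H G by (rule N)
  have c: "h \<in> carrier G" "\<psi> x \<in> carrier G" using h x \<psi> by (auto simp: abelian_mapD)
  have "inv (\<psi> x) \<otimes> h \<otimes> \<psi> x \<in> H" using c h by (simp add: inv_op_closed1)
  moreover have "x \<otimes>\<^bsub>circle_group G \<psi>\<^esub> (y \<otimes> h)
      = (x \<otimes>\<^bsub>circle_group G \<psi>\<^esub> y) \<otimes> (inv (\<psi> x) \<otimes> h \<otimes> \<psi> x)"
    using c x y by (simp add: circle_group_def abelian_mapD[OF \<psi>] m_assoc inv_mult_cancel)
  ultimately show ?thesis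
    using l_coset_absorb[OF subgroup_axioms circle_closed[OF \<psi> x y]] by simp
qed

lemma coset_action_circle:
  assumes "abelian_map G \<psi>" "H \<lhd> G" "g \<in> carrier G" "x \<in> carrier G"
  shows "coset_action G H (circle_group G \<psi>) g (x <# H) =
    (g \<otimes>\<^bsub>circle_group G \<psi>\<^esub> x) <# H"
  using assms by (intro coset_action_apply circle_mult_normal normal_imp_subgroup)

lemma coset_quotient_self:
  assumes N: "H \<lhd> G" and "x \<in> carrier G" "y \<in> carrier G"
  shows "(x <# H) \<otimes>\<^bsub>coset_quotient G H G\<^esub> (y <# H) = (x \<otimes> y) <# H"
    and "(x <# H) \<otimes>\<^bsub>coset_quotient G H (opposite_group G)\<^esub> (y <# H) = (y \<otimes> x) <# H"
proof -
  interpret normal H G by (rule N)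
  have *: "((a \<otimes> h) \<otimes> (b \<otimes> k)) <# H = (a \<otimes> b) <# H"
    if "a \<in> carrier G" "b \<in> carrier G" "h \<in> H" "k \<in> H" for a b h k
  proof -
    have c: "h \<in> carrier G" "k \<in> carrier G" using that by auto
    have "(a \<otimes> h) \<otimes> (b \<otimes> k) = (a \<otimes> b) \<otimes> ((inv b \<otimes> h \<otimes> b) \<otimes> k)"
      using that c by (simp add: m_assoc inv_mult_cancel)
    moreover have "(inv b \<otimes> h \<otimes> b) \<otimes> k \<in> H" using that inv_op_closed1 by simp
    ultimately show ?thesis using l_coset_absorb[OF subgroup_axioms] that by simp
  qed
  show "(x <# H) \<otimes>\<^bsub>coset_quotient G H G\<^esub> (y <# H) = (x \<otimes> y) <# H"
    using coset_quotient_mult[OF subgroup_axioms, of x y G] assms * by blast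
  show "(x <# H) \<otimes>\<^bsub>coset_quotient G H (opposite_group G)\<^esub> (y <# H) = (y \<otimes> x) <# H"
    using coset_quotient_mult[OF subgroup_axioms, of x y "opposite_group G"] assms *
    by (simp add: opposite_group_def)
qed

lemma circle_mult_C1:
  assumes \<psi>: "abelian_map G \<psi>" and H: "subgroup H G"
    and C: "commutator_subgroup G (carrier G) (phi_map G \<psi> ` H) \<subseteq> H"
    and x: "x \<in> carrier G" and y: "y \<in> carrier G" and h: "h \<in> H" and k: "k \<in> H"
  shows "((x \<otimes> h) \<otimes>\<^bsub>circle_group G \<psi>\<^esub> (y \<otimes> k)) <# H
    = (x \<otimes>\<^bsub>circle_group G \<psi>\<^esub> y) <# H"
proof -
  let ?p = "phi_map G \<psi>"
  interpret subgroup H G by (rule H)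
  note D = abelian_mapD[OF \<psi>]
  have p_closed: "?p u \<in> carrier G" if "u \<in> carrier G" for u
    using that D by (simp add: phi_map_def)
  have p_split: "u = ?p u \<otimes> \<psi> u" if "u \<in> carrier G" for u
    using that D by (simp add: phi_map_def m_assoc)
  have comm: "g \<otimes> ?p u \<otimes> inv g \<otimes> inv (?p u) \<in> H" if "g \<in> carrier G" "u \<in> H" for g u
    using that by (intro subsetD[OF C[unfolded commutator_subgroup_def]] generate.incl) blast
  have conj: "inv (\<psi> g) \<otimes> u \<otimes> \<psi> g \<in> H" if g: "g \<in> carrier G" and u: "u \<in> H" for g u
  proof -
    have uc: "u \<in> carrier G" using u by simp
    note c = g uc D(1)[OF g] D(1)[OF uc] p_closed[OF uc]
    have "inv (\<psi> g) \<otimes> u \<otimes> \<psi> g = inv (\<psi> g) \<otimes> (?p u \<otimes> \<psi> u) \<otimes> \<psi> g"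
      using p_split[OF uc] by simp
    also have "\<dots> = inv (\<psi> g) \<otimes> ?p u \<otimes> (\<psi> g \<otimes> \<psi> u)"
      using c D(4)[OF uc g] by (simp add: m_assoc)
    also have "\<dots> = (inv (\<psi> g) \<otimes> ?p u \<otimes> inv (inv (\<psi> g)) \<otimes> inv (?p u)) \<otimes> (?p u \<otimes> \<psi> u)"
      using c by (simp add: m_assoc inv_mult_cancel)
    finally show ?thesis
      using comm[of "inv (\<psi> g)" u] c u p_split[OF uc] by simp
  qed
  have hc: "h \<in> carrier G" and kc: "k \<in> carrier G" using h k by auto
  note c = x y hc kc D(1)[OF x] D(1)[OF hc] p_closed[OF hc]
  define z where "z = y \<otimes> k"
  define t where "t = inv (\<psi> x) \<otimes> z \<otimes> \<psi> x"
  define u where "u = inv (\<psi> x) \<otimes> k \<otimes> \<psi> x"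
  define w where "w = inv t \<otimes> ?p h \<otimes> inv (inv t) \<otimes> inv (?p h) \<otimes> h"
  have zc: "z \<in> carrier G" and tc: "t \<in> carrier G" using c by (simp_all add: z_def t_def)
  have uH: "u \<in> H" using conj[OF x k] by (simp add: u_def)
  have wH: "w \<in> H" using comm[of "inv t" h] h tc by (simp add: w_def)
  have uwc: "u \<in> carrier G" "w \<in> carrier G" using uH wH by auto
  have "inv (\<psi> x \<otimes> \<psi> h) = inv (\<psi> h \<otimes> \<psi> x)" using D(4)[OF x hc] by simp
  then have i: "inv (\<psi> x \<otimes> \<psi> h) = inv (\<psi> x) \<otimes> inv (\<psi> h)"
    using c by (simp add: inv_mult_group)
  have i': "inv (\<psi> x) \<otimes> inv (\<psi> h) = inv (\<psi> h) \<otimes> inv (\<psi> x)"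
    using i c by (simp add: inv_mult_group)
  have "(x \<otimes> h) \<otimes>\<^bsub>circle_group G \<psi>\<^esub> z
      = x \<otimes> h \<otimes> inv (\<psi> x \<otimes> \<psi> h) \<otimes> z \<otimes> (\<psi> x \<otimes> \<psi> h)"
    using c D by (simp add: circle_group_def del: inv_mult_group)
  also have "\<dots> = x \<otimes> (?p h \<otimes> t \<otimes> \<psi> h)"
    unfolding i i' using c zc D(3)[OF hc] by (simp add: t_def phi_map_def m_assoc)
  also have "?p h \<otimes> t \<otimes> \<psi> h = t \<otimes> (inv t \<otimes> ?p h \<otimes> t \<otimes> inv (?p h) \<otimes> (?p h \<otimes> \<psi> h))"
    using c tc by (simp add: m_assoc inv_mult_cancel)
  also have "\<dots> = t \<otimes> w"
    using p_split[OF hc] tc by (simp add: w_def)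
  also have "x \<otimes> (t \<otimes> w) = (x \<otimes>\<^bsub>circle_group G \<psi>\<^esub> y) \<otimes> (u \<otimes> w)"
    using c zc uwc(2) by (simp add: circle_group_def D(3)[OF x] t_def u_def z_def m_assoc inv_mult_cancel)
  finally have "(x \<otimes> h) \<otimes>\<^bsub>circle_group G \<psi>\<^esub> z = \<dots>" .
  then show ?thesis
    using l_coset_absorb[OF H circle_closed[OF \<psi> x y], of "u \<otimes> w"] uH wH by (simp add: z_def)
qed

lemma coset_quotient_circle:
  assumes "abelian_map G \<psi>" "subgroup H G"
    and "commutator_subgroup G (carrier G) (phi_map G \<psi> ` H) \<subseteq> H"
    and "x \<in> carrier G" "y \<in> carrier G"
  shows "(x <# H) \<otimes>\<^bsub>coset_quotient G H (circle_group G \<psi>)\<^esub> (y <# H) =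
      (x \<otimes>\<^bsub>circle_group G \<psi>\<^esub> y) <# H"
    and "(x <# H) \<otimes>\<^bsub>coset_quotient G H (opposite_group (circle_group G \<psi>))\<^esub> (y <# H) =
      (y \<otimes>\<^bsub>circle_group G \<psi>\<^esub> x) <# H"
proof -
  show "(x <# H) \<otimes>\<^bsub>coset_quotient G H (circle_group G \<psi>)\<^esub> (y <# H) =
      (x \<otimes>\<^bsub>circle_group G \<psi>\<^esub> y) <# H"
    by (rule coset_quotient_mult) (use assms circle_mult_C1 in blast)+
  show "(x <# H) \<otimes>\<^bsub>coset_quotient G H (opposite_group (circle_group G \<psi>))\<^esub> (y <# H) =
      (y \<otimes>\<^bsub>circle_group G \<psi>\<^esub> x) <# H"
    using coset_quotient_mult[of H x y "opposite_group (circle_group G \<psi>)"] assms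
      circle_mult_C1[OF assms(1-3)]
    by (simp add: opposite_group_def)
qed

end

end

theory Submission
  imports Defs
begin

text \<open>
  Both \<open>(G, \<cdot>, \<circ>)\<close> and \<open>(G, \<circ>, \<cdot>)\<close> are skew braces, and replacing the additive group of a skew
  brace by its opposite gives a skew brace again. All claims follow by pushing these braces forward
  along \<open>x \<mapsto> xH\<close>: if it is a homomorphism for the additive operation and is compatible with left
  multiplication, the image is a bracoid; if it is a homomorphism for both operations, the image
  is a brace.
\<close>

section \<open>Transport along surjections, transitive actions, opposite groups\<close>

text \<open>Membership in \<open>hom G K\<close> presupposes no group axioms for \<open>K\<close>,
  so they can be carried over from \<open>G\<close>: the image group of \<open>f\<close> is
  \<open>K\<close> itself, since carrier and unit agree.\<close>

lemma (in group) surj_hom_imp_group: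
  assumes "f \<in> hom G K" "carrier K = f ` carrier G" "\<one>\<^bsub>K\<^esub> = f \<one>"
  shows "group K"
proof -
  have "K\<lparr>carrier := f ` carrier G, one := f \<one>\<rparr> = K"
    using assms(2,3) by simp
  then show ?thesis using hom_imp_img_group[OF assms(1)] by simp
qed

text \<open>The action of the inverse of \<open>g\<close> is a two-sided inverse of
  \<open>act g\<close>, so the pointwise laws already give a homomorphism into
  \<open>BijGroup E\<close>. Extensionality turns agreement on \<open>E\<close> into equality of
  functions.\<close>

lemma transitive_actionI:
  assumes "group \<Gamma>"
    and ext: "\<And>g. g \<in> carrier \<Gamma> \<Longrightarrow> act g \<in> extensional E"
    and closed: "\<And>g x. \<lbrakk>g \<in> carrier \<Gamma>; x \<in> E\<rbrakk> \<Longrightarrow> act g x \<in> E"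
    and one: "\<And>x. x \<in> E \<Longrightarrow> act \<one>\<^bsub>\<Gamma>\<^esub> x = x"
    and mult: "\<And>g h x. \<lbrakk>g \<in> carrier \<Gamma>; h \<in> carrier \<Gamma>; x \<in> E\<rbrakk> \<Longrightarrow>
      act (g \<otimes>\<^bsub>\<Gamma>\<^esub> h) x = act g (act h x)"
    and trans: "\<And>x y. \<lbrakk>x \<in> E; y \<in> E\<rbrakk> \<Longrightarrow> \<exists>g\<in>carrier \<Gamma>. act g x = y"
  shows "transitive_action \<Gamma> E act"
proof -
  interpret \<Gamma>: group \<Gamma> by fact
  have Bij: "act g \<in> Bij E" if g: "g \<in> carrier \<Gamma>" for g
  proof -
    have "act (inv\<^bsub>\<Gamma>\<^esub> g) (act g x) = x" "act g (act (inv\<^bsub>\<Gamma>\<^esub> g) x) = x" if "x \<in> E" for x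
      using that g mult[symmetric] one by simp_all
    then have "bij_betw (act g) E E"
      using g closed by (intro bij_betw_byWitness[where f' = "act (inv\<^bsub>\<Gamma>\<^esub> g)"]) auto
    then show ?thesis using ext g by (simp add: Bij_def)
  qed
  have "act (g \<otimes>\<^bsub>\<Gamma>\<^esub> h) = compose E (act g) (act h)"
    if "g \<in> carrier \<Gamma>" "h \<in> carrier \<Gamma>" for g h
    using that mult ext by (intro extensionalityI[of _ E]) (simp_all add: compose_def)
  then have "act \<in> hom \<Gamma> (BijGroup E)"
    using Bij by (auto simp: hom_def BijGroup_def)
  then have "group_hom \<Gamma> (BijGroup E) act"
    by (simp add: group_hom_def group_hom_axioms_def group_BijGroup assms(1))
  then show ?thesis
    using trans by (simp add: transitive_action_def transitive_action_axioms_def group_action_def)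
qed

lemma (in group) opposite_group_is_group: "group (opposite_group G)"
  by (rule groupI) (auto simp: opposite_group_def m_assoc intro: r_inv_ex)

lemma (in group) inv_opposite_group:
  assumes "x \<in> carrier G"
  shows "inv\<^bsub>opposite_group G\<^esub> x = inv x"
  using assms
  by (intro group.inv_equality[OF opposite_group_is_group]) (auto simp: opposite_group_def)

section \<open>Opposites and images of braces\<close>

context skew_brace
begin

lemma mul_closed: "\<lbrakk>a \<in> carrier A; b \<in> carrier A\<rbrakk> \<Longrightarrow> a \<otimes>\<^bsub>M\<^esub> b \<in> carrier A"
  using mul.m_closed carrier_eq by simp

text \<open>In the brace relation with \<open>a\<close> the multiplicative unit and
  \<open>b\<close>, \<open>c\<close> the additive unit, everything but the additive inverse of
  \<open>a\<close> cancels.\<close>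

lemma one_eq: "\<one>\<^bsub>M\<^esub> = \<one>\<^bsub>A\<^esub>"
proof -
  let ?e = "\<one>\<^bsub>M\<^esub>" and ?z = "\<one>\<^bsub>A\<^esub>"
  have e: "?e \<in> carrier A" "?z \<in> carrier M" using mul.one_closed carrier_eq by auto
  have "?e \<otimes>\<^bsub>M\<^esub> (?z \<otimes>\<^bsub>A\<^esub> ?z) = ((?e \<otimes>\<^bsub>M\<^esub> ?z) \<otimes>\<^bsub>A\<^esub> inv\<^bsub>A\<^esub> ?e) \<otimes>\<^bsub>A\<^esub> (?e \<otimes>\<^bsub>M\<^esub> ?z)"
    using e by (intro brace_relation) auto
  then have "inv\<^bsub>A\<^esub> ?e = ?z" using e by simp
  then show ?thesis using e add.inv_inv[of ?e] by simp
qed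

text \<open>Reversing the addition turns the relation for \<open>a\<close>, \<open>b\<close>,
  \<open>c\<close> into the original one for \<open>a\<close>, \<open>c\<close>, \<open>b\<close>,
  up to associativity.\<close>

lemma opposite: "skew_brace (opposite_group A) M"
proof (intro skew_brace.intro skew_brace_axioms.intro)
  show "group (opposite_group A)" by (rule add.opposite_group_is_group)
  show "group M" by (rule mul.group_axioms)
  show "carrier M = carrier (opposite_group A)"
    using carrier_eq by (simp add: opposite_group_def)
  fix a b c assume "a \<in> carrier (opposite_group A)" "b \<in> carrier (opposite_group A)"
    "c \<in> carrier (opposite_group A)"
  then have "a \<in> carrier A" "b \<in> carrier A" "c \<in> carrier A"
    by (simp_all add: opposite_group_def)
  then show "a \<otimes>\<^bsub>M\<^esub> (b \<otimes>\<^bsub>opposite_group A\<^esub> c) =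
      ((a \<otimes>\<^bsub>M\<^esub> b) \<otimes>\<^bsub>opposite_group A\<^esub> inv\<^bsub>opposite_group A\<^esub> a) \<otimes>\<^bsub>opposite_group A\<^esub> (a \<otimes>\<^bsub>M\<^esub> c)"
    using brace_relation[of a c b] mul_closed[of a b] mul_closed[of a c]
    \<comment> \<open>The inverse is rewritten while \<open>opposite_group A\<close> is still
      folded; only then is the operation unfolded.\<close>
    by (simp add: add.inv_opposite_group) (simp add: opposite_group_def add.m_assoc)
qed

text \<open>By surjectivity the targets inherit the group axioms, and each instance of the brace
  relation there is the image under \<open>f\<close> of an instance in the source.\<close>

lemma image_skew_brace:
  assumes hA: "f \<in> hom A A'" and cA: "carrier A' = f ` carrier A" and oA: "\<one>\<^bsub>A'\<^esub> = f \<one>\<^bsub>A\<^esub>"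
    and hM: "f \<in> hom M M'" and cM: "carrier M' = f ` carrier M" and oM: "\<one>\<^bsub>M'\<^esub> = f \<one>\<^bsub>M\<^esub>"
  shows "skew_brace A' M'"
proof (intro skew_brace.intro skew_brace_axioms.intro)
  show gA: "group A'" using hA cA oA by (rule add.surj_hom_imp_group)
  show "group M'" using hM cM oM by (rule mul.surj_hom_imp_group)
  show "carrier M' = carrier A'" using cA cM carrier_eq by simp
  interpret f: group_hom A A' f
    using hA gA by (simp add: group_hom_def group_hom_axioms_def add.group_axioms)
  have m: "f (a \<otimes>\<^bsub>M\<^esub> b) = f a \<otimes>\<^bsub>M'\<^esub> f b" if "a \<in> carrier A" "b \<in> carrier A" for a b
    using that hM carrier_eq by (simp add: hom_mult)
  fix a b c assume "a \<in> carrier A'" "b \<in> carrier A'" "c \<in> carrier A'"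
  then obtain x y z where x: "x \<in> carrier A" "y \<in> carrier A" "z \<in> carrier A"
    and a: "a = f x" "b = f y" "c = f z" using cA by auto
  show "a \<otimes>\<^bsub>M'\<^esub> (b \<otimes>\<^bsub>A'\<^esub> c) = ((a \<otimes>\<^bsub>M'\<^esub> b) \<otimes>\<^bsub>A'\<^esub> inv\<^bsub>A'\<^esub> a) \<otimes>\<^bsub>A'\<^esub> (a \<otimes>\<^bsub>M'\<^esub> c)"
    using arg_cong[OF brace_relation[OF x], of f] x mul_closed unfolding a
    by (simp add: m)
qed

text \<open>Here \<open>f\<close> respects the addition, while the multiplication survives as an
  action: \<open>f\<close> intertwines left multiplication in \<open>M\<close> with
  \<open>act\<close>.\<close>

lemma image_skew_bracoid:
  assumes h: "f \<in> hom A N" and c: "carrier N = f ` carrier A" and o: "\<one>\<^bsub>N\<^esub> = f \<one>\<^bsub>A\<^esub>"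
    and ext: "\<And>g. g \<in> carrier A \<Longrightarrow> act g \<in> extensional (carrier N)"
    and act: "\<And>g x. \<lbrakk>g \<in> carrier A; x \<in> carrier A\<rbrakk> \<Longrightarrow> act g (f x) = f (g \<otimes>\<^bsub>M\<^esub> x)"
  shows "skew_bracoid M N act"
proof (intro skew_bracoid.intro skew_bracoid_axioms.intro)
  show gN: "group N" using h c o by (rule add.surj_hom_imp_group)
  interpret f: group_hom A N f
    using h gN by (simp add: group_hom_def group_hom_axioms_def add.group_axioms)
  note ce = carrier_eq
  show "transitive_action M (carrier N) act"
  proof (rule transitive_actionI)
    fix x y assume "x \<in> carrier N" "y \<in> carrier N"
    then obtain u v where u: "u \<in> carrier M" "v \<in> carrier M" "x = f u" "y = f v"
      using c ce by auto
    \<comment> \<open>This element carries \<open>u\<close> to \<open>v\<close> in the regular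
      action of \<open>M\<close> on itself.\<close>
    have "act (v \<otimes>\<^bsub>M\<^esub> inv\<^bsub>M\<^esub> u) x = y"
      using u act[of "v \<otimes>\<^bsub>M\<^esub> inv\<^bsub>M\<^esub> u" u] ce[symmetric] by (simp add: mul.m_assoc)
    then show "\<exists>g\<in>carrier M. act g x = y" using u by blast
  next
    fix g k x assume g: "g \<in> carrier M" "k \<in> carrier M" and "x \<in> carrier N"
    then obtain u where u: "u \<in> carrier M" "x = f u" using c ce by auto
    then show "act (g \<otimes>\<^bsub>M\<^esub> k) x = act g (act k x)"
      using g act ce[symmetric] by (simp add: mul.m_assoc)
  qed (use c ce ext act mul.group_axioms mul_closed mul.l_one mul.one_closed in auto)
  fix g \<eta> \<mu> assume g: "g \<in> carrier M" and "\<eta> \<in> carrier N" "\<mu> \<in> carrier N"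
  then obtain x y where x: "x \<in> carrier A" "y \<in> carrier A" "\<eta> = f x" "\<mu> = f y"
    using c by auto
  have gA: "g \<in> carrier A" using g ce by simp
  \<comment> \<open>The two units of a brace agree, so the inverse in the bracoid relation is the
    image of the additive inverse of \<open>g\<close> in the brace relation.\<close>
  have "act g \<one>\<^bsub>N\<^esub> = f g" using o act[OF gA, of "\<one>\<^bsub>A\<^esub>"] mul.r_one[OF g] by (simp add: one_eq)
  then show "act g (\<eta> \<otimes>\<^bsub>N\<^esub> \<mu>) =
      (act g \<eta> \<otimes>\<^bsub>N\<^esub> inv\<^bsub>N\<^esub> (act g \<one>\<^bsub>N\<^esub>)) \<otimes>\<^bsub>N\<^esub> act g \<mu>"
    using arg_cong[OF brace_relation[OF gA x(1,2)], of f] x gA mul_closed act[OF gA, of "x \<otimes>\<^bsub>A\<^esub> y"]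
    by (simp add: act)
qed

end

section \<open>The circle group and its two braces\<close>

context group
begin

lemma circle_mult:
  assumes "abelian_map G \<psi>" "x \<in> carrier G"
  shows "x \<otimes>\<^bsub>circle_group G \<psi>\<^esub> y = x \<otimes> inv (\<psi> x) \<otimes> y \<otimes> \<psi> x"
  using assms by (simp add: circle_group_def abelian_mapD)

text \<open>The factor \<open>\<psi> (\<psi> x)\<close> and its inverse surround
  \<open>\<psi> y\<close> and commute with it, so they cancel. Thus \<open>\<psi>\<close> is
  multiplicative from \<open>\<circ>\<close> to \<open>\<cdot>\<close> as well, which is the key to
  associativity of \<open>\<circ>\<close>.\<close>

lemma abelian_map_circle:
  assumes \<psi>: "abelian_map G \<psi>" and x: "x \<in> carrier G" and y: "y \<in> carrier G"
  shows "\<psi> (x \<otimes>\<^bsub>circle_group G \<psi>\<^esub> y) = \<psi> x \<otimes> \<psi> y"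
proof -
  note D = abelian_mapD[OF \<psi>]
  have c: "\<psi> x \<in> carrier G" "\<psi> y \<in> carrier G" "\<psi> (\<psi> x) \<in> carrier G"
    using D(1) x y by auto
  have "\<psi> (x \<otimes>\<^bsub>circle_group G \<psi>\<^esub> y) = \<psi> x \<otimes> (inv (\<psi> (\<psi> x)) \<otimes> (\<psi> y \<otimes> \<psi> (\<psi> x)))"
    using x y c by (simp add: circle_mult[OF \<psi>] D m_assoc)
  also have "\<psi> y \<otimes> \<psi> (\<psi> x) = \<psi> (\<psi> x) \<otimes> \<psi> y" using D(4) y c by blast
  finally show ?thesis using c by (simp add: inv_mult_cancel)
qed

text \<open>The element \<open>x'\<close> is the inverse of \<open>x\<close> for
  \<open>\<circ>\<close>. The product formula serves twice: at \<open>y = x\<close> it gives the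
  inverse law, and at \<open>y = x \<otimes> c\<close> it gives the conjugate of \<open>c\<close> by
  \<open>\<psi> x\<close>.\<close>

lemma circle_inverse:
  assumes \<psi>: "abelian_map G \<psi>" and x: "x \<in> carrier G"
  defines "x' \<equiv> \<psi> x \<otimes> inv x \<otimes> inv (\<psi> x)"
  shows "x' \<in> carrier G"
    and "\<And>y. y \<in> carrier G \<Longrightarrow> x' \<otimes>\<^bsub>circle_group G \<psi>\<^esub> y = \<psi> x \<otimes> inv x \<otimes> y \<otimes> inv (\<psi> x)"
proof -
  note D = abelian_mapD[OF \<psi>]
  have c: "\<psi> x \<in> carrier G" "\<psi> (\<psi> x) \<in> carrier G" using D(1) x by auto
  show x': "x' \<in> carrier G" using x c by (simp add: x'_def)
  have "\<psi> x' = \<psi> (\<psi> x) \<otimes> (inv (\<psi> x) \<otimes> inv (\<psi> (\<psi> x)))"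
    using x c by (simp add: x'_def D m_assoc)
  \<comment> \<open>Both factors are values of \<open>\<psi>\<close>, at \<open>inv x\<close> and
    \<open>inv (\<psi> x)\<close>, so they commute.\<close>
  also have "inv (\<psi> x) \<otimes> inv (\<psi> (\<psi> x)) = inv (\<psi> (\<psi> x)) \<otimes> inv (\<psi> x)"
    using D(4)[of "inv x" "inv (\<psi> x)"] x c by (simp add: D)
  finally have \<psi>x': "\<psi> x' = inv (\<psi> x)" using c by (simp add: inv_mult_cancel)
  show "x' \<otimes>\<^bsub>circle_group G \<psi>\<^esub> y = \<psi> x \<otimes> inv x \<otimes> y \<otimes> inv (\<psi> x)"
    if "y \<in> carrier G" for y
    using that x c x' by (simp add: circle_mult[OF \<psi>] \<psi>x') (simp add: x'_def m_assoc inv_mult_cancel)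
qed

text \<open>For associativity, both bracketings conjugate \<open>z\<close> by the same product of
  \<open>\<psi> x\<close> and \<open>\<psi> y\<close>, whose order does not matter.\<close>

lemma circle_group_is_group:
  assumes \<psi>: "abelian_map G \<psi>"
  shows "group (circle_group G \<psi>)"
proof (rule groupI)
  note D = abelian_mapD[OF \<psi>]
  have [simp]: "carrier (circle_group G \<psi>) = carrier G" "\<one>\<^bsub>circle_group G \<psi>\<^esub> = \<one>"
    by (simp_all add: circle_group_def)
  have [simp]: "\<psi> \<one> = \<one>"
    using hom_one[of \<psi> G] \<psi> group_axioms unfolding abelian_map_def by blast
  fix x assume "x \<in> carrier (circle_group G \<psi>)"
  then have x: "x \<in> carrier G" by simp
  then show "\<one>\<^bsub>circle_group G \<psi>\<^esub> \<otimes>\<^bsub>circle_group G \<psi>\<^esub> x = x" by (simp add: circle_mult[OF \<psi>])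
  have "(\<psi> x \<otimes> inv x \<otimes> inv (\<psi> x)) \<otimes>\<^bsub>circle_group G \<psi>\<^esub> x = \<one>"
    using x D(1)[OF x] by (subst circle_inverse(2)[OF \<psi> x x]) (simp add: m_assoc)
  then show "\<exists>y\<in>carrier (circle_group G \<psi>). y \<otimes>\<^bsub>circle_group G \<psi>\<^esub> x = \<one>\<^bsub>circle_group G \<psi>\<^esub>"
    using circle_inverse(1)[OF \<psi> x] by auto
  fix y assume "y \<in> carrier (circle_group G \<psi>)"
  then have y: "y \<in> carrier G" by simp
  show "x \<otimes>\<^bsub>circle_group G \<psi>\<^esub> y \<in> carrier (circle_group G \<psi>)"
    using circle_closed[OF \<psi> x y] by simp
  fix z assume "z \<in> carrier (circle_group G \<psi>)"
  then have z: "z \<in> carrier G" by simp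
  have c: "\<psi> x \<in> carrier G" "\<psi> y \<in> carrier G" using D(1) x y by auto
  \<comment> \<open>Commutativity yields the unreversed order of the inverses, which puts
    \<open>inv (\<psi> x)\<close> next to the \<open>\<psi> x\<close> that it cancels in the product
    below.\<close>
  have "inv (\<psi> x \<otimes> \<psi> y) = inv (\<psi> y) \<otimes> inv (\<psi> x)" using c by (simp add: inv_mult_group)
  then have i: "inv (\<psi> x \<otimes> \<psi> y) = inv (\<psi> x) \<otimes> inv (\<psi> y)"
    using D(4)[of "inv x" "inv y"] x y by (simp add: D)
  have "(x \<otimes>\<^bsub>circle_group G \<psi>\<^esub> y) \<otimes>\<^bsub>circle_group G \<psi>\<^esub> z
      = x \<otimes> inv (\<psi> x) \<otimes> y \<otimes> \<psi> x \<otimes> (inv (\<psi> x) \<otimes> inv (\<psi> y)) \<otimes> z \<otimes> (\<psi> x \<otimes> \<psi> y)"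
    unfolding circle_mult[OF \<psi> circle_closed[OF \<psi> x y]] abelian_map_circle[OF \<psi> x y] i
    by (simp add: circle_mult[OF \<psi> x])
  also have "\<dots> = x \<otimes> inv (\<psi> x) \<otimes> (y \<otimes> inv (\<psi> y) \<otimes> z \<otimes> \<psi> y) \<otimes> \<psi> x"
    using x y z c D(4)[OF x y] by (simp add: m_assoc inv_mult_cancel)
  finally show "(x \<otimes>\<^bsub>circle_group G \<psi>\<^esub> y) \<otimes>\<^bsub>circle_group G \<psi>\<^esub> z
      = x \<otimes>\<^bsub>circle_group G \<psi>\<^esub> (y \<otimes>\<^bsub>circle_group G \<psi>\<^esub> z)"
    by (simp add: circle_mult[OF \<psi> x] circle_mult[OF \<psi> y])
qed (simp_all add: circle_group_def)

text \<open>The product \<open>a \<circ> y\<close> is \<open>a\<close> times the conjugate of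
  \<open>y\<close> by \<open>inv (\<psi> a)\<close>. Conjugation respects \<open>\<cdot>\<close>,
  and \<open>inv a\<close> removes the second copy of \<open>a\<close>.\<close>

lemma skew_brace_circle:
  assumes \<psi>: "abelian_map G \<psi>"
  shows "skew_brace G (circle_group G \<psi>)"
proof (intro skew_brace.intro skew_brace_axioms.intro)
  fix a b c assume "a \<in> carrier G" "b \<in> carrier G" "c \<in> carrier G"
  then show "a \<otimes>\<^bsub>circle_group G \<psi>\<^esub> (b \<otimes> c) =
      ((a \<otimes>\<^bsub>circle_group G \<psi>\<^esub> b) \<otimes> inv a) \<otimes> (a \<otimes>\<^bsub>circle_group G \<psi>\<^esub> c)"
    by (simp add: circle_mult[OF \<psi>] abelian_mapD(1)[OF \<psi>] m_assoc inv_mult_cancel)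
qed (simp_all add: group_axioms circle_group_is_group[OF \<psi>], simp add: circle_group_def)

text \<open>The \<open>\<circ>\<close>-inverse of \<open>a\<close> sends
  \<open>a \<otimes> c\<close> to the conjugate of \<open>c\<close> by \<open>\<psi> a\<close>. Left
  \<open>\<circ>\<close>-multiplication by \<open>a \<otimes> b\<close> undoes this conjugation and
  leaves the one by \<open>inv (\<psi> b)\<close>, as in \<open>b \<circ> c\<close>.\<close>

lemma circle_skew_brace:
  assumes \<psi>: "abelian_map G \<psi>"
  shows "skew_brace (circle_group G \<psi>) G"
proof (intro skew_brace.intro skew_brace_axioms.intro)
  note D = abelian_mapD[OF \<psi>]
  let ?C = "circle_group G \<psi>"
  interpret C: group ?C by (rule circle_group_is_group[OF \<psi>])
  have car: "carrier ?C = carrier G" by (simp add: circle_group_def)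
  then show "carrier G = carrier ?C" by simp
  fix a b c assume "a \<in> carrier ?C" "b \<in> carrier ?C" "c \<in> carrier ?C"
  then have abc: "a \<in> carrier G" "b \<in> carrier G" "c \<in> carrier G" by (simp_all add: car)
  let ?a = "\<psi> a \<otimes> inv a \<otimes> inv (\<psi> a)"
  have cl: "\<psi> a \<in> carrier G" "\<psi> b \<in> carrier G" using D(1) abc by auto
  note a' = circle_inverse[OF \<psi> abc(1)]
  have "?a \<otimes>\<^bsub>?C\<^esub> a = \<one>\<^bsub>?C\<^esub>"
    using abc cl a'(2)[OF abc(1)] by (simp add: circle_group_def m_assoc)
  then have inv_a: "inv\<^bsub>?C\<^esub> a = ?a"
    using abc a'(1) by (intro C.inv_equality) (simp_all add: car)
  have "((a \<otimes> b) \<otimes>\<^bsub>?C\<^esub> inv\<^bsub>?C\<^esub> a) \<otimes>\<^bsub>?C\<^esub> (a \<otimes> c) = (a \<otimes> b) \<otimes>\<^bsub>?C\<^esub> (?a \<otimes>\<^bsub>?C\<^esub> (a \<otimes> c))"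
    unfolding inv_a using abc a'(1) by (intro C.m_assoc) (simp_all add: car)
  also have "?a \<otimes>\<^bsub>?C\<^esub> (a \<otimes> c) = \<psi> a \<otimes> c \<otimes> inv (\<psi> a)"
    using abc cl by (subst a'(2)) (simp_all add: m_assoc inv_mult_cancel)
  also have "(a \<otimes> b) \<otimes>\<^bsub>?C\<^esub> (\<psi> a \<otimes> c \<otimes> inv (\<psi> a)) =
      a \<otimes> b \<otimes> (inv (\<psi> b) \<otimes> inv (\<psi> a)) \<otimes> (\<psi> a \<otimes> c \<otimes> inv (\<psi> a)) \<otimes> (\<psi> a \<otimes> \<psi> b)"
    using abc cl by (simp add: circle_mult[OF \<psi>] D(2) inv_mult_group)
  also have "\<dots> = a \<otimes> (b \<otimes>\<^bsub>?C\<^esub> c)"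
    using abc cl by (simp add: circle_mult[OF \<psi>] m_assoc inv_mult_cancel)
  finally show "a \<otimes> (b \<otimes>\<^bsub>?C\<^esub> c) = ((a \<otimes> b) \<otimes>\<^bsub>?C\<^esub> inv\<^bsub>?C\<^esub> a) \<otimes>\<^bsub>?C\<^esub> (a \<otimes> c)" by simp
qed (simp_all add: group_axioms circle_group_is_group[OF \<psi>])

section \<open>Passage to cosets\<close>

text \<open>The operation \<open>M\<close> is kept general, with cosets always formed in
  \<open>G\<close>, so that \<open>\<cdot>\<close>, \<open>\<circ>\<close> and their opposites are
  treated alike. The group axioms of \<open>M\<close> supply closure of products.\<close>

lemma coset_quotient_hom:
  assumes "carrier M = carrier G"
    and "\<And>x y. \<lbrakk>x \<in> carrier G; y \<in> carrier G\<rbrakk> \<Longrightarrow>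
      (x <# H) \<otimes>\<^bsub>coset_quotient G H M\<^esub> (y <# H) = (x \<otimes>\<^bsub>M\<^esub> y) <# H"
  shows "group M \<Longrightarrow> (\<lambda>x. x <# H) \<in> hom M (coset_quotient G H M)"
    and "carrier (coset_quotient G H M) = (\<lambda>x. x <# H) ` carrier M"
proof -
  show c: "carrier (coset_quotient G H M) = (\<lambda>x. x <# H) ` carrier M"
    using assms(1) by (auto simp: coset_quotient_def LCOSETS_def)
  show "(\<lambda>x. x <# H) \<in> hom M (coset_quotient G H M)" if "group M"
    using assms c by (auto simp: hom_def)
qed

lemma coset_action_extensional:
  "coset_action G H M g \<in> extensional ((\<lambda>x. x <# H) ` carrier G)"
proof -
  have "lcosets H = (\<lambda>x. x <# H) ` carrier G" by (auto simp: LCOSETS_def)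
  then show ?thesis by (simp add: coset_action_def)
qed

end

theorem theorem2:
  fixes G :: "('a, 'b) monoid_scheme" and \<psi> :: "'a \<Rightarrow> 'a" and H :: "'a set"
  assumes "group G" and "abelian_map G \<psi>" and "subgroup H G"
  shows "let
      C1 = (commutator_subgroup G (carrier G) (phi_map G \<psi> ` H) \<subseteq> H);
      C2 = (H \<lhd> G);
      circ = circle_group G \<psi>;
      GH_dot = coset_quotient G H G;
      GH_dot' = coset_quotient G H (opposite_group G);
      GH_circ = coset_quotient G H circ;
      GH_circ' = coset_quotient G H (opposite_group circ)
    in
      (C1 \<longrightarrow> skew_bracoid G GH_circ (coset_action G H G)
            \<and> skew_bracoid G GH_circ' (coset_action G H G)) \<and>
      (C2 \<longrightarrow> skew_bracoid circ GH_dot (coset_action G H circ)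
            \<and> skew_bracoid circ GH_dot' (coset_action G H circ)) \<and>
      (C1 \<and> C2 \<longrightarrow> skew_brace GH_dot GH_circ
            \<and> skew_brace GH_circ' GH_dot
            \<and> skew_brace GH_dot' GH_circ)"
proof -
  interpret group G by fact
  note \<psi> = assms(2) and H = assms(3)
  let ?C = "circle_group G \<psi>" and ?q = "\<lambda>x. x <#\<^bsub>G\<^esub> H"
  let ?G' = "opposite_group G" and ?C' = "opposite_group ?C"
  \<comment> \<open>The names list the additive group first. Every structure in the conclusion is an
    image of one of these four braces.\<close>
  interpret GC: skew_brace G ?C by (rule skew_brace_circle[OF \<psi>])
  interpret CG: skew_brace ?C G by (rule circle_skew_brace[OF \<psi>])
  interpret G'C: skew_brace ?G' ?C by (rule GC.opposite)
  interpret C'G: skew_brace ?C' G by (rule CG.opposite)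
  have car: "carrier ?C = carrier G" "carrier ?G' = carrier G" "carrier ?C' = carrier G"
    by (simp_all add: circle_group_def opposite_group_def)
  have circ: "?q \<in> hom ?C (coset_quotient G H ?C)
      \<and> carrier (coset_quotient G H ?C) = ?q ` carrier ?C
      \<and> ?q \<in> hom ?C' (coset_quotient G H ?C')
      \<and> carrier (coset_quotient G H ?C') = ?q ` carrier ?C'"
    if "commutator_subgroup G (carrier G) (phi_map G \<psi> ` H) \<subseteq> H"
  proof -
    have "?q x \<otimes>\<^bsub>coset_quotient G H ?C\<^esub> ?q y = ?q (x \<otimes>\<^bsub>?C\<^esub> y)"
      "?q x \<otimes>\<^bsub>coset_quotient G H ?C'\<^esub> ?q y = ?q (x \<otimes>\<^bsub>?C'\<^esub> y)"
      if "x \<in> carrier G" "y \<in> carrier G" for x y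
      using coset_quotient_circle[OF \<psi> H \<open>_ \<subseteq> H\<close> that] by (simp_all add: opposite_group_def)
    then show ?thesis
      using coset_quotient_hom[of ?C H] coset_quotient_hom[of ?C' H]
        car GC.mul.group_axioms C'G.add.group_axioms by blast
  qed
  have dot: "?q \<in> hom G (coset_quotient G H G)
      \<and> carrier (coset_quotient G H G) = ?q ` carrier G
      \<and> ?q \<in> hom ?G' (coset_quotient G H ?G')
      \<and> carrier (coset_quotient G H ?G') = ?q ` carrier ?G'"
    if "H \<lhd> G"
  proof -
    have "?q x \<otimes>\<^bsub>coset_quotient G H G\<^esub> ?q y = ?q (x \<otimes>\<^bsub>G\<^esub> y)"
      "?q x \<otimes>\<^bsub>coset_quotient G H ?G'\<^esub> ?q y = ?q (x \<otimes>\<^bsub>?G'\<^esub> y)"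
      if "x \<in> carrier G" "y \<in> carrier G" for x y
      using coset_quotient_self[OF \<open>H \<lhd> G\<close> that] by (simp_all add: opposite_group_def)
    then show ?thesis
      using coset_quotient_hom[of G H] coset_quotient_hom[of ?G' H]
        car group_axioms G'C.add.group_axioms by blast
  qed
  \<comment> \<open>Stated for every record type, since \<open>G\<close> may be an extended record
    while the circle and opposite groups are plain monoids.\<close>
  have one: "\<one>\<^bsub>coset_quotient G H M\<^esub> = ?q \<one>\<^bsub>M\<^esub>" for M :: "('a, 'c) monoid_scheme"
    by (simp add: coset_quotient_def)
  show ?thesis
    unfolding Let_def
  proof (intro conjI impI)
    assume C1: "commutator_subgroup G (carrier G) (phi_map G \<psi> ` H) \<subseteq> H"
    note q = circ[OF C1]
    \<comment> \<open>The additive group of the source brace passes to the quotient and its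
      multiplicative group acts, hence \<open>CG\<close>. Left multiplication in \<open>G\<close>
      permutes the left cosets of any subgroup, so \<open>C1\<close> enters through the quotient
      operation.\<close>
    show "skew_bracoid G (coset_quotient G H ?C) (coset_action G H G)"
      by (rule CG.image_skew_bracoid[where f = ?q])
        (use q one coset_action_extensional car coset_action_self[OF H] in auto)
    show "skew_bracoid G (coset_quotient G H ?C') (coset_action G H G)"
      by (rule C'G.image_skew_bracoid[where f = ?q])
        (use q one coset_action_extensional car coset_action_self[OF H] in auto)
  next
    assume C2: "H \<lhd> G"
    note q = dot[OF C2]
    \<comment> \<open>Normality enters twice: through the quotient operation and through the action,
      where \<open>g \<circ> x\<close> changes by a conjugate of \<open>h\<close> when
      \<open>x\<close> is replaced by \<open>x \<otimes> h\<close>.\<close>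
    show "skew_bracoid ?C (coset_quotient G H G) (coset_action G H ?C)"
      by (rule GC.image_skew_bracoid[where f = ?q])
        (use q one coset_action_extensional car coset_action_circle[OF \<psi> C2] in auto)
    show "skew_bracoid ?C (coset_quotient G H ?G') (coset_action G H ?C)"
      by (rule G'C.image_skew_bracoid[where f = ?q])
        (use q one coset_action_extensional car coset_action_circle[OF \<psi> C2] in auto)
  next
    assume "commutator_subgroup G (carrier G) (phi_map G \<psi> ` H) \<subseteq> H \<and> H \<lhd> G"
    then have q: "commutator_subgroup G (carrier G) (phi_map G \<psi> ` H) \<subseteq> H" "H \<lhd> G" by auto
    note q = circ[OF q(1)] dot[OF q(2)]
    show "skew_brace (coset_quotient G H G) (coset_quotient G H ?C)"
      by (rule GC.image_skew_brace[where f = ?q]) (use q one in auto)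
    show "skew_brace (coset_quotient G H ?C') (coset_quotient G H G)"
      by (rule C'G.image_skew_brace[where f = ?q]) (use q one in auto)
    show "skew_brace (coset_quotient G H ?G') (coset_quotient G H ?C)"
      by (rule G'C.image_skew_brace[where f = ?q]) (use q one in auto)
  qed
qed

end
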